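(* Let $G$ be a very well-covered graph of order $n\geq 2$ with $\alpha(G)=\alpha$. Then: (i) $(\alpha-k)\cdot s_{k}\leq (k+1)\cdot s_{k+1}\leq 2(\alpha-k)\cdot s_{k}$ for all integers $0\leq k<\alpha$; (ii) $s_{0}\leq s_{1}\leq\cdots\leq s_{\lceil\alpha/2\rceil}$ and $s_{\lceil(2\alpha-1)/3\rceil}\geq\cdots\geq s_{\alpha-1}\geq s_{\alpha}$ (the latter meaning $s_k\geq s_{k+1}$ for every integer $k$ with $\lceil(2\alpha-1)/3\rceil\leq k<\alpha$); (iii) if $\alpha\geq 2$, then $s_{\alpha-2}\cdot s_{\alpha}\leq s_{\alpha-1}^{2}$; (iv) if $\alpha\leq 9$, then the independence polynomial $I(G;x)$ is unimodal; (v) if $\alpha\leq 5$, then the independence polynomial $I(G;x)$ is log-concave.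
   Context: All graphs are finite, undirected, without loops or multiple edges. A stable set is a set of pairwise non-adjacent vertices (the empty set is stable). The stability number $\alpha(G)$ is the maximum cardinality of a stable set in $G$, and $s_k$ denotes the number of stable sets of cardinality $k$ in $G$, for $0\leq k\leq\alpha(G)$. The independence polynomial of $G$ is $I(G;x)=\sum_{k=0}^{\alpha(G)}s_k x^k$. A graph is well-covered if all its maximal (with respect to inclusion) stable sets have the same cardinality; it is very well-covered if, in addition, it has no isolated vertices and its order equals $2\alpha(G)$. A finite sequence of real numbers $(a_0,\dots,a_n)$ is unimodal if there is some $k\in\{0,\dots,n\}$ with $a_0\leq\cdots\leq a_{k-1}\leq a_k\geq a_{k+1}\geq\cdots\geq a_n$, and log-concave if $a_i^2\geq a_{i-1}a_{i+1}$ for all $i\in\{1,\dots,n-1\}$. A polynomial is unimodal (log-concave) if its sequence of coefficients is unimodal (log-concave). *)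

theory Defs
  imports Complex_Main "Graph_Theory.Pair_Digraph" "HOL-Computational_Algebra.Polynomial"
begin

text \<open>
  A finite simple undirected graph is rendered by the Graph Theory locale \<^locale>\<open>pair_graph\<close>:
  finitely many vertices, and a loop-free symmetric set of pairs of vertices as adjacency relation.
\<close>

definition stable_set :: "'a pair_pre_digraph \<Rightarrow> 'a set \<Rightarrow> bool" where
  "stable_set G S \<longleftrightarrow> S \<subseteq> pverts G \<and> (\<forall>u\<in>S. \<forall>v\<in>S. (u, v) \<notin> parcs G)"

definition maximal_stable_set :: "'a pair_pre_digraph \<Rightarrow> 'a set \<Rightarrow> bool" where
  "maximal_stable_set G S \<longleftrightarrow> stable_set G S \<and> (\<forall>T. stable_set G T \<and> S \<subseteq> T \<longrightarrow> T = S)"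

definition stability_number :: "'a pair_pre_digraph \<Rightarrow> nat" where
  "stability_number G = Max (card ` {S. stable_set G S})"

definition num_stable_sets :: "'a pair_pre_digraph \<Rightarrow> nat \<Rightarrow> nat" where
  "num_stable_sets G k = card {S. stable_set G S \<and> card S = k}"

definition independence_poly :: "'a pair_pre_digraph \<Rightarrow> real poly" where
  "independence_poly G = (\<Sum>k\<le>stability_number G. monom (real (num_stable_sets G k)) k)"

definition well_covered :: "'a pair_pre_digraph \<Rightarrow> bool" where
  "well_covered G \<longleftrightarrow>
     (\<forall>S T. maximal_stable_set G S \<and> maximal_stable_set G T \<longrightarrow> card S = card T)"

definition isolated_vertex :: "'a pair_pre_digraph \<Rightarrow> 'a \<Rightarrow> bool" where
  "isolated_vertex G v \<longleftrightarrow> v \<in> pverts G \<and> (\<forall>w\<in>pverts G. (v, w) \<notin> parcs G)"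

definition very_well_covered :: "'a pair_pre_digraph \<Rightarrow> bool" where
  "very_well_covered G \<longleftrightarrow>
     well_covered G \<and> (\<nexists>v. isolated_vertex G v) \<and> card (pverts G) = 2 * stability_number G"

text \<open>In the next two definitions the finite sequence is \<open>a 0, \<dots>, a n\<close>; \<open>a\<close> is ignored beyond \<open>n\<close>.\<close>

definition unimodal_seq :: "nat \<Rightarrow> (nat \<Rightarrow> real) \<Rightarrow> bool" where
  "unimodal_seq n a \<longleftrightarrow>
     (\<exists>k\<le>n. (\<forall>i<k. a i \<le> a (i + 1)) \<and> (\<forall>i. k \<le> i \<and> i < n \<longrightarrow> a i \<ge> a (i + 1)))"

definition log_concave_seq :: "nat \<Rightarrow> (nat \<Rightarrow> real) \<Rightarrow> bool" where
  "log_concave_seq n a \<longleftrightarrow> (\<forall>i. 1 \<le> i \<and> i < n \<longrightarrow> (a i)\<^sup>2 \<ge> a (i - 1) * a (i + 1))"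

definition unimodal_poly :: "real poly \<Rightarrow> bool" where
  "unimodal_poly p \<longleftrightarrow> unimodal_seq (degree p) (coeff p)"

definition log_concave_poly :: "real poly \<Rightarrow> bool" where
  "log_concave_poly p \<longleftrightarrow> log_concave_seq (degree p) (coeff p)"

end

theory Submission
  imports Defs
begin

text \<open>
  In a well-covered graph without isolated vertices every stable set \<open>A\<close> satisfies
  \<open>|A| \<le> |N(A)|\<close> (Berge). So a stable set of size \<open>k\<close> in a very well-covered graph has at most
  \<open>2\<alpha> - 2k\<close> one-point stable extensions, and it has at least \<open>\<alpha> - k\<close> because it lies in a stable
  set of size \<open>\<alpha>\<close>. Counting pairs \<open>A \<subset> B\<close> of stable sets of sizes \<open>k\<close> and \<open>k + 1\<close> gives (i).
  The remaining parts are arithmetic consequences of (i).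
\<close>

definition neighbourhood :: "'a pair_pre_digraph \<Rightarrow> 'a set \<Rightarrow> 'a set" where
  "neighbourhood G A = {v. \<exists>u\<in>A. (u, v) \<in> parcs G}"

text \<open>Stability of \<open>insert v A\<close> already places \<open>v\<close> among the
  vertices of \<open>G\<close>.\<close>

definition stable_extensions :: "'a pair_pre_digraph \<Rightarrow> 'a set \<Rightarrow> 'a set" where
  "stable_extensions G A = {v. v \<notin> A \<and> stable_set G (insert v A)}"

section \<open>Stable sets, maximality and Berge's inequality\<close>

lemma stable_set_empty: "stable_set G {}"
  by (simp add: stable_set_def)

lemma stable_set_subset: "stable_set G B \<Longrightarrow> A \<subseteq> B \<Longrightarrow> stable_set G A"
  unfolding stable_set_def by blast

context pair_graph
begin

lemma parcs_sym: "(u, v) \<in> parcs G \<Longrightarrow> (v, u) \<in> parcs G"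
  using pair_sym_arcs by (auto simp: symmetric_def sym_def)

lemma neighbourhood_subset: "neighbourhood G A \<subseteq> pverts G"
  unfolding neighbourhood_def using in_arcsD2 by blast

lemma finite_neighbourhood: "finite (neighbourhood G A)"
  using neighbourhood_subset pair_finite_verts finite_subset by blast

lemma stable_set_finite: "stable_set G A \<Longrightarrow> finite A"
  using pair_finite_verts finite_subset unfolding stable_set_def by blast

lemma finite_stable_sets: "finite {S. stable_set G S}"
  by (rule finite_subset[of _ "Pow (pverts G)"]) (auto simp: stable_set_def pair_finite_verts)

lemma card_le_stability_number: "stable_set G A \<Longrightarrow> card A \<le> stability_number G"
  unfolding stability_number_def using finite_stable_sets by (intro Max_ge) auto

lemma stable_set_insert:
  assumes "stable_set G A" "v \<in> pverts G" "v \<notin> neighbourhood G A"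
  shows "stable_set G (insert v A)"
proof -
  have "(v, v) \<notin> parcs G"
    using pair_no_loops by fastforce
  then show ?thesis
    using assms parcs_sym unfolding stable_set_def neighbourhood_def by blast
qed

lemma ex_maximum_stable_set: "\<exists>S. stable_set G S \<and> card S = stability_number G"
proof -
  have "stability_number G \<in> card ` {S. stable_set G S}"
    unfolding stability_number_def
    using finite_stable_sets stable_set_empty by (intro Max_in) auto
  then show ?thesis by auto
qed

lemma ex_maximal_stable_superset:
  assumes "stable_set G A"
  shows "\<exists>S. A \<subseteq> S \<and> maximal_stable_set G S"
proof -
  have "\<exists>S\<in>{S. stable_set G S}. A \<subseteq> S \<and> (\<forall>T\<in>{S. stable_set G S}. S \<subseteq> T \<longrightarrow> S = T)"
    using finite_has_maximal2[OF finite_stable_sets, of A] assms by simp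
  then show ?thesis
    unfolding maximal_stable_set_def by blast
qed

lemma maximal_stable_set_if_card:
  assumes "stable_set G S" "card S = stability_number G"
  shows "maximal_stable_set G S"
  unfolding maximal_stable_set_def
proof (intro conjI allI impI)
  fix T assume "stable_set G T \<and> S \<subseteq> T"
  then show "T = S"
    using card_le_stability_number[of T] assms(2) card_seteq[of T S] stable_set_finite by auto
qed (fact assms(1))

text \<open>A stable set of maximum size is itself maximal, so it fixes the common size of all
  maximal stable sets.\<close>

lemma well_covered_card_maximal:
  assumes "well_covered G" "maximal_stable_set G S"
  shows "card S = stability_number G"
  using assms ex_maximum_stable_set maximal_stable_set_if_card unfolding well_covered_def by metis

text \<open>Strong induction on \<open>card A\<close>. A maximal stable set \<open>Y\<close> that
  misses some point of \<open>A\<close> splits \<open>A\<close>: the part \<open>A - Y\<close> is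
  bounded by an exchange inside \<open>Y\<close>, the smaller part \<open>A \<inter> Y\<close> by
  induction, and the two bounds use disjoint pieces of the neighbourhood.\<close>

lemma card_le_card_neighbourhood:
  assumes wc: "well_covered G" and no_iso: "\<nexists>v. isolated_vertex G v"
  shows "stable_set G A \<Longrightarrow> card A \<le> card (neighbourhood G A)"
proof (induction "card A" arbitrary: A rule: less_induct)
  case less
  note finA = stable_set_finite[OF less.prems]
  show ?case
  proof (cases "A = {}")
    case False
    then obtain a where a: "a \<in> A" by blast
    then have "a \<in> pverts G"
      using less.prems unfolding stable_set_def by blast
    then obtain v where v: "(a, v) \<in> parcs G"
      using no_iso unfolding isolated_vertex_def by blast
    have "stable_set G {v}"
      using v pair_no_loops in_arcsD2 unfolding stable_set_def by fastforce
    \<comment> \<open>Passing through a neighbour \<open>v\<close> of \<open>a\<close> forces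
      \<open>a \<notin> Y\<close>, which makes \<open>A \<inter> Y\<close> a proper subset of
      \<open>A\<close>.\<close>
    then obtain Y where Y: "v \<in> Y" "maximal_stable_set G Y"
      using ex_maximal_stable_superset by blast
    have stY: "stable_set G Y" using Y(2) unfolding maximal_stable_set_def by blast
    have cY: "card Y = stability_number G" using wc Y(2) by (rule well_covered_card_maximal)
    note finY = stable_set_finite[OF stY]
    let ?N = "neighbourhood G A"
    txt \<open>Exchanging \<open>Y \<inter> N(A)\<close> for \<open>A - Y\<close> keeps \<open>Y\<close> stable, and \<open>Y\<close> has maximum size.\<close>
    have "stable_set G ((Y - ?N) \<union> A)"
      using stY less.prems parcs_sym unfolding stable_set_def neighbourhood_def by blast
    then have "card ((Y - ?N) \<union> A) \<le> card Y"
      using cY card_le_stability_number by simp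
    moreover have "A \<inter> ?N = {}"
      using less.prems unfolding stable_set_def neighbourhood_def by blast
    \<comment> \<open>Points of \<open>A \<inter> Y\<close> survive the removal of
      \<open>?N\<close>, so only \<open>A - Y\<close> is really added.\<close>
    then have "(Y - ?N) \<union> A = (Y - ?N) \<union> (A - Y)" by blast
    moreover have "card ((Y - ?N) \<union> (A - Y)) = card (Y - ?N) + card (A - Y)"
      using finA finY by (intro card_Un_disjoint) auto
    moreover have "card Y = card (Y - ?N) + card (Y \<inter> ?N)"
      using finY by (subst card_Un_disjoint[symmetric]) (auto intro: arg_cong[where f = card])
    ultimately have exchange: "card (A - Y) \<le> card (Y \<inter> ?N)"
      by simp
    have "a \<notin> Y"
      using stY Y(1) v unfolding stable_set_def by blast
    then have "card (A \<inter> Y) < card A"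
      using a finA by (intro psubset_card_mono) auto
    then have IH: "card (A \<inter> Y) \<le> card (neighbourhood G (A \<inter> Y))"
      using less.hyps less.prems stable_set_subset by blast
    have "card A = card (A - Y) + card (A \<inter> Y)"
      using finA by (subst card_Un_disjoint[symmetric]) (auto intro: arg_cong[where f = card])
    also have "\<dots> \<le> card (Y \<inter> ?N) + card (neighbourhood G (A \<inter> Y))"
      using exchange IH by simp
    \<comment> \<open>A common point would lie in \<open>Y\<close> and be adjacent to a point of
      \<open>A \<inter> Y\<close>, against the stability of \<open>Y\<close>.\<close>
    also have "\<dots> = card ((Y \<inter> ?N) \<union> neighbourhood G (A \<inter> Y))"
      using finY finite_neighbourhood stY
      by (intro card_Un_disjoint[symmetric]) (auto simp: stable_set_def neighbourhood_def)
    also have "\<dots> \<le> card ?N"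
      using finite_neighbourhood by (intro card_mono) (auto simp: neighbourhood_def)
    finally show ?thesis .
  qed simp
qed

section \<open>One-point stable extensions and double counting\<close>

lemma stable_extensions_subset:
  "stable_extensions G A \<subseteq> pverts G - (A \<union> neighbourhood G A)"
  unfolding stable_extensions_def stable_set_def neighbourhood_def by blast

lemma finite_stable_extensions: "finite (stable_extensions G A)"
  using stable_extensions_subset pair_finite_verts by (meson finite_Diff finite_subset)

text \<open>Each point of \<open>S - A\<close> extends \<open>A\<close>, where \<open>S\<close> is a
  maximal stable set containing \<open>A\<close>.\<close>

lemma card_stable_extensions_ge:
  assumes "well_covered G" "stable_set G A"
  shows "stability_number G - card A \<le> card (stable_extensions G A)"
proof -
  obtain S where S: "A \<subseteq> S" "maximal_stable_set G S"
    using ex_maximal_stable_superset assms(2) by blast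
  then have "stable_set G S" unfolding maximal_stable_set_def by blast
  then have "S - A \<subseteq> stable_extensions G A"
    using S(1) by (auto simp: stable_extensions_def intro: stable_set_subset)
  then have "card (S - A) \<le> card (stable_extensions G A)"
    by (rule card_mono[OF finite_stable_extensions])
  then show ?thesis
    using well_covered_card_maximal[OF assms(1) S(2)] card_Diff_subset S(1)
      stable_set_finite[OF assms(2)] by metis
qed

text \<open>Extensions avoid the disjoint sets \<open>A\<close> and
  \<open>neighbourhood G A\<close>, which by Berge's inequality cover at least
  \<open>2 * card A\<close> of the \<open>2 * stability_number G\<close> vertices.\<close>

lemma card_stable_extensions_le:
  assumes vwc: "very_well_covered G" and st: "stable_set G A"
  shows "card (stable_extensions G A) \<le> 2 * (stability_number G - card A)"
proof -
  let ?N = "neighbourhood G A"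
  have "card A \<le> card ?N"
    using vwc st by (intro card_le_card_neighbourhood) (auto simp: very_well_covered_def)
  moreover have "card (A \<union> ?N) = card A + card ?N"
    using st stable_set_finite finite_neighbourhood
    by (intro card_Un_disjoint) (auto simp: stable_set_def neighbourhood_def)
  moreover have "A \<union> ?N \<subseteq> pverts G"
    using st neighbourhood_subset unfolding stable_set_def by blast
  then have "card (pverts G - (A \<union> ?N)) = card (pverts G) - card (A \<union> ?N)"
    using pair_finite_verts by (intro card_Diff_subset) (auto intro: finite_subset)
  moreover have "card (stable_extensions G A) \<le> card (pverts G - (A \<union> ?N))"
    using pair_finite_verts by (intro card_mono stable_extensions_subset) auto
  moreover have "card (pverts G) = 2 * stability_number G"
    using vwc unfolding very_well_covered_def by blast
  ultimately show ?thesis by simp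
qed

text \<open>Double counting of pairs \<open>A \<subset> B\<close> of stable sets of sizes
  \<open>k\<close> and \<open>k + 1\<close>: all \<open>k + 1\<close> subsets of \<open>B\<close> of
  size \<open>k\<close> are stable, and the sets \<open>B\<close> above \<open>A\<close> correspond
  to its extension vertices.\<close>

lemma sum_card_stable_extensions:
  "(\<Sum>A | stable_set G A \<and> card A = k. card (stable_extensions G A))
     = (k + 1) * num_stable_sets G (k + 1)"
proof -
  let ?S = "\<lambda>k. {A. stable_set G A \<and> card A = k}"
  have fin: "finite (?S k)" for k
    by (rule finite_subset[OF _ finite_stable_sets]) auto
  have down: "card {A \<in> ?S k. A \<subset> B} = k + 1" if B: "B \<in> ?S (k + 1)" for B
  proof -
    have finB: "finite B" using B by (auto intro: stable_set_finite)
    have "{A \<in> ?S k. A \<subset> B} = {A. A \<subseteq> B \<and> card A = k}"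
      using B by (auto intro: stable_set_subset)
    then show ?thesis
      using n_subsets[OF finB, of k] B by (simp add: binomial_symmetric[of k "Suc k"])
  qed
  have up: "card {B \<in> ?S (k + 1). A \<subset> B} = card (stable_extensions G A)" if A: "A \<in> ?S k" for A
  proof -
    have finA: "finite A" using A by (auto intro: stable_set_finite)
    have "{B \<in> ?S (k + 1). A \<subset> B} = (\<lambda>v. insert v A) ` stable_extensions G A"
    proof (intro equalityI subsetI)
      fix B assume B: "B \<in> {B \<in> ?S (k + 1). A \<subset> B}"
      then have "card (B - A) = 1"
        using A finA by (simp add: card_Diff_subset psubset_imp_subset)
      then obtain v where "B - A = {v}" by (auto simp: card_1_singleton_iff)
      then have "B = insert v A" "v \<notin> A" using B by auto
      then show "B \<in> (\<lambda>v. insert v A) ` stable_extensions G A"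
        using B by (auto simp: stable_extensions_def)
    qed (use A finA in \<open>auto simp: stable_extensions_def\<close>)
    moreover have "inj_on (\<lambda>v. insert v A) (stable_extensions G A)"
      by (auto simp: inj_on_def stable_extensions_def)
    ultimately show ?thesis by (simp add: card_image)
  qed
  have "(\<Sum>A\<in>?S k. card {B \<in> ?S (k + 1). A \<subset> B}) = (k + 1) * card (?S (k + 1))"
    using down by (intro sum_multicount fin) blast
  then show ?thesis
    using up by (simp add: num_stable_sets_def)
qed

lemma num_stable_sets_Suc_ge:
  assumes "well_covered G"
  shows "(stability_number G - k) * num_stable_sets G k \<le> (k + 1) * num_stable_sets G (k + 1)"
proof -
  have "(\<Sum>A | stable_set G A \<and> card A = k. stability_number G - k)
      \<le> (\<Sum>A | stable_set G A \<and> card A = k. card (stable_extensions G A))"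
    using card_stable_extensions_ge[OF assms] by (intro sum_mono) auto
  then show ?thesis
    unfolding sum_card_stable_extensions by (simp add: num_stable_sets_def mult.commute)
qed

lemma num_stable_sets_Suc_le:
  assumes "very_well_covered G"
  shows "(k + 1) * num_stable_sets G (k + 1) \<le> 2 * (stability_number G - k) * num_stable_sets G k"
proof -
  have "(\<Sum>A | stable_set G A \<and> card A = k. card (stable_extensions G A))
      \<le> (\<Sum>A | stable_set G A \<and> card A = k. 2 * (stability_number G - k))"
    using card_stable_extensions_le[OF assms] by (intro sum_mono) auto
  then show ?thesis
    unfolding sum_card_stable_extensions by (simp add: num_stable_sets_def mult.commute)
qed

section \<open>The independence polynomial and arithmetic of sequences\<close>

lemma coeff_independence_poly:
  "k \<le> stability_number G \<Longrightarrow> coeff (independence_poly G) k = real (num_stable_sets G k)"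
  by (simp add: independence_poly_def coeff_sum)

lemma degree_independence_poly: "degree (independence_poly G) = stability_number G"
proof (rule antisym)
  show "degree (independence_poly G) \<le> stability_number G"
    unfolding independence_poly_def
    by (rule degree_sum_le) (auto intro: order_trans[OF degree_monom_le])
  have "finite {S. stable_set G S \<and> card S = stability_number G}"
    by (rule finite_subset[OF _ finite_stable_sets]) auto
  then have "num_stable_sets G (stability_number G) \<noteq> 0"
    using ex_maximum_stable_set by (auto simp: num_stable_sets_def)
  then show "stability_number G \<le> degree (independence_poly G)"
    by (intro le_degree) (simp add: coeff_independence_poly)
qed

end

text \<open>Here \<open>a\<close>, \<open>b\<close>, \<open>c\<close> stand for
  \<open>s (k - 1)\<close>, \<open>s k\<close>, \<open>s (k + 1)\<close>, and \<open>m\<close> for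
  \<open>\<alpha> - k\<close>. Multiplying the two bounds from (i), at \<open>k - 1\<close> and at
  \<open>k\<close>, compares \<open>a * c\<close> with \<open>b\<^sup>2\<close>.\<close>

lemma log_concave_step:
  fixes a b c k m :: nat
  assumes lower: "(m + 1) * a \<le> k * b" and upper: "(k + 1) * c \<le> 2 * m * b"
    and small: "2 * (k * m) \<le> (k + 1) * (m + 1)"
  shows "a * c \<le> b\<^sup>2"
proof -
  have "((k + 1) * (m + 1)) * (a * c) = ((m + 1) * a) * ((k + 1) * c)"
    by (simp only: ac_simps)
  also have "\<dots> \<le> (k * b) * (2 * m * b)"
    using lower upper by (rule mult_le_mono)
  also have "\<dots> = 2 * (k * m) * b\<^sup>2"
    by (simp add: power2_eq_square)
  also have "\<dots> \<le> ((k + 1) * (m + 1)) * b\<^sup>2"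
    using small by (rule mult_le_mono1)
  finally show ?thesis
    by (subst (asm) mult_le_cancel1) simp
qed

text \<open>Only the comparison of \<open>a p\<close> with \<open>a (p + 1)\<close> is left open;
  its outcome decides whether the mode is \<open>p + 1\<close> or \<open>p\<close>.\<close>

lemma unimodal_seq_if_gap_le_1:
  assumes "p \<le> n"
    and up: "\<And>i. i < p \<Longrightarrow> a i \<le> a (i + 1)"
    and down: "\<And>i. p < i \<Longrightarrow> i < n \<Longrightarrow> a (i + 1) \<le> a i"
  shows "unimodal_seq n a"
proof (cases "p < n \<and> a p < a (p + 1)")
  case True
  then have "\<forall>i<p + 1. a i \<le> a (i + 1)"
    using up by (auto simp: less_Suc_eq)
  then show ?thesis
    unfolding unimodal_seq_def using True down by (intro exI[of _ "p + 1"]) auto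
next
  case False
  then have "\<forall>i. p \<le> i \<and> i < n \<longrightarrow> a i \<ge> a (i + 1)"
    using down by (metis le_neq_implies_less linorder_not_less order_le_less)
  then show ?thesis
    unfolding unimodal_seq_def using assms by blast
qed

theorem theorem2p5:
  fixes G :: "'a pair_pre_digraph" and n \<alpha> :: nat and s :: "nat \<Rightarrow> nat"
  assumes "pair_graph G"
    and "very_well_covered G"
    and "card (pverts G) = n" and "n \<ge> 2"
    and "stability_number G = \<alpha>"
  defines "s \<equiv> num_stable_sets G"
  shows
    "(\<forall>k<\<alpha>. (\<alpha> - k) * s k \<le> (k + 1) * s (k + 1)
              \<and> (k + 1) * s (k + 1) \<le> 2 * (\<alpha> - k) * s k)
     \<and> ((\<forall>k. int k < \<lceil>real \<alpha> / 2\<rceil> \<longrightarrow> s k \<le> s (k + 1))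
        \<and> (\<forall>k. \<lceil>(2 * real \<alpha> - 1) / 3\<rceil> \<le> int k \<and> k < \<alpha> \<longrightarrow> s k \<ge> s (k + 1)))
     \<and> (\<alpha> \<ge> 2 \<longrightarrow> s (\<alpha> - 2) * s \<alpha> \<le> (s (\<alpha> - 1))\<^sup>2)
     \<and> (\<alpha> \<le> 9 \<longrightarrow> unimodal_poly (independence_poly G))
     \<and> (\<alpha> \<le> 5 \<longrightarrow> log_concave_poly (independence_poly G))"
proof -
  interpret pair_graph G by fact
  note \<alpha> = \<open>stability_number G = \<alpha>\<close>
  have wc: "well_covered G"
    using assms(2) unfolding very_well_covered_def by blast
  have lower: "(\<alpha> - k) * s k \<le> (k + 1) * s (k + 1)" for k
    using num_stable_sets_Suc_ge[OF wc] by (simp add: s_def flip: \<alpha>)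
  have upper: "(k + 1) * s (k + 1) \<le> 2 * (\<alpha> - k) * s k" for k
    using num_stable_sets_Suc_le[OF assms(2)] by (simp add: s_def flip: \<alpha>)
  have increasing: "s k \<le> s (k + 1)" if "2 * k < \<alpha>" for k
  proof -
    \<comment> \<open>The assumption \<open>2 * k < \<alpha>\<close> says exactly that
      \<open>k + 1 \<le> \<alpha> - k\<close>.\<close>
    have "(k + 1) * s k \<le> (\<alpha> - k) * s k"
      using that by (intro mult_le_mono1) linarith
    also have "\<dots> \<le> (k + 1) * s (k + 1)" by (rule lower)
    finally show ?thesis by (auto simp only: mult_le_cancel1)
  qed
  have decreasing: "s (k + 1) \<le> s k" if "2 * \<alpha> \<le> 3 * k + 1" for k
  proof -
    have "(k + 1) * s (k + 1) \<le> 2 * (\<alpha> - k) * s k" by (rule upper)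
    \<comment> \<open>The assumption yields \<open>2 * (\<alpha> - k) \<le> k + 1\<close>.\<close>
    also have "\<dots> \<le> (k + 1) * s k"
      using that by (intro mult_le_mono1) linarith
    finally show ?thesis by (auto simp only: mult_le_cancel1)
  qed
  have log_concave: "s (k - 1) * s (k + 1) \<le> (s k)\<^sup>2"
    if k: "1 \<le> k" "k < \<alpha>" and small: "2 * (k * (\<alpha> - k)) \<le> (k + 1) * (\<alpha> - k + 1)" for k
  proof (rule log_concave_step[OF _ upper small])
    show "(\<alpha> - k + 1) * s (k - 1) \<le> k * s k"
      using lower[of "k - 1"] k by (simp add: Suc_diff_le del: mult_Suc)
  qed
  have "s k \<le> s (k + 1)" if "int k < \<lceil>real \<alpha> / 2\<rceil>" for k
    using that by (intro increasing) (simp add: less_ceiling_iff)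
  moreover have "s (k + 1) \<le> s k" if "\<lceil>(2 * real \<alpha> - 1) / 3\<rceil> \<le> int k" for k
    using that by (intro decreasing) (simp add: ceiling_le_iff)
  moreover have "s (\<alpha> - 2) * s \<alpha> \<le> (s (\<alpha> - 1))\<^sup>2" if "\<alpha> \<ge> 2"
    \<comment> \<open>With \<open>\<alpha> - k = 1\<close> both sides of the smallness condition
      equal \<open>2 * \<alpha> - 2\<close> and \<open>2 * \<alpha>\<close> respectively.\<close>
    using log_concave[of "\<alpha> - 1"] that by (simp add: numeral_2_eq_2)
  moreover have "unimodal_poly (independence_poly G)" if "\<alpha> \<le> 9"
  proof -
    have "unimodal_seq \<alpha> (coeff (independence_poly G))"
    \<comment> \<open>The value \<open>(\<alpha> + 1) div 2\<close> is the ceiling of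
      \<open>\<alpha> / 2\<close>, where the guaranteed increase ends.\<close>
    proof (rule unimodal_seq_if_gap_le_1[of "(\<alpha> + 1) div 2"])
      fix i assume "i < (\<alpha> + 1) div 2"
      then show "coeff (independence_poly G) i \<le> coeff (independence_poly G) (i + 1)"
        using increasing[of i] by (simp add: coeff_independence_poly \<alpha> s_def)
    next
      fix i assume i: "(\<alpha> + 1) div 2 < i" "i < \<alpha>"
      \<comment> \<open>This is where \<open>\<alpha> \<le> 9\<close> enters: for
        \<open>\<alpha> = 10\<close> the index \<open>i = 6\<close> would violate it.\<close>
      then have "2 * \<alpha> \<le> 3 * i + 1"
        using that by linarith
      then show "coeff (independence_poly G) (i + 1) \<le> coeff (independence_poly G) i"
        using decreasing[of i] i by (simp add: coeff_independence_poly \<alpha> s_def)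
    qed linarith
    then show ?thesis
      by (simp add: unimodal_poly_def degree_independence_poly \<alpha>)
  qed
  moreover have "log_concave_poly (independence_poly G)" if "\<alpha> \<le> 5"
    unfolding log_concave_poly_def log_concave_seq_def degree_independence_poly \<alpha>
  proof (intro allI impI)
    fix k assume k: "1 \<le> k \<and> k < \<alpha>"
    define m where "m = \<alpha> - k"
    have "k \<in> {1, 2, 3, 4}" "m \<in> {1, 2, 3, 4}" "k + m \<le> 5"
      using k that unfolding m_def by auto
    \<comment> \<open>The inequality amounts to \<open>(k - 1) * (m - 1) \<le> 2\<close>; the
      extreme cases are \<open>k = 2, m = 3\<close> and the reverse.\<close>
    then have "2 * (k * m) \<le> (k + 1) * (m + 1)"
      by auto
    then have "s (k - 1) * s (k + 1) \<le> (s k)\<^sup>2"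
      using log_concave k unfolding m_def by blast
    then have "real (s (k - 1)) * real (s (k + 1)) \<le> (real (s k))\<^sup>2"
      by (metis of_nat_le_iff of_nat_mult of_nat_power)
    moreover have "k - 1 \<le> \<alpha>"
      using k by linarith
    ultimately show "coeff (independence_poly G) (k - 1) * coeff (independence_poly G) (k + 1)
        \<le> (coeff (independence_poly G) k)\<^sup>2"
      using k by (simp add: coeff_independence_poly \<alpha> s_def)
  qed
  ultimately show ?thesis
    using lower upper by blast
qed

end
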